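(* Let $\Gamma$ be a nonempty graph with vertex set $X = V(\Gamma)$ (of arbitrary cardinality), and let $\overline{\Gamma}$ be the complement of $\Gamma$. Then the following conditions are equivalent: (i) The inequality $|V(H)| \leq 2$ holds for every connected subgraph $H$ of $\overline{\Gamma}$. (ii) For every metric space $(X,d)$ (that is, for every metric $d$ on the set $X$), the equality $G_{X,d} = \Gamma$ implies that $(X,d)$ is ultrametric.
   Context: Graphs are simple: a graph $G=(V,E)$ consists of a nonempty set $V=V(G)$ of arbitrary cardinality and a set $E=E(G)$ of unordered pairs $\{u,v\}$ of distinct points of $V$. A graph $G$ is called empty if $E(G)=\varnothing$, and nonempty otherwise. A graph $H$ is a subgraph of $G$ if $V(H)\subseteq V(G)$ and $E(H)\subseteq E(G)$. A graph is connected if every two distinct vertices are joined by a (finite) path in it. The complement $\overline{G}$ has $V(\overline{G})=V(G)$ and, for distinct $x,y$, $\{x,y\}\in E(\overline{G})$ iff $\{x,y\}\notin E(G)$. For a nonempty metric space $(X,d)$, $\operatorname{diam} X=\sup\{d(x,y): x,y\in X\}\in[0,\infty]$. The diametrical graph $G_{X,d}$ is the graph with vertex set $X$ in which $\{u,v\}$ is an edge iff $u\neq v$ and $d(u,v)=\operatorname{diam} X$. A metric space $(X,d)$ is ultrametric if $d(x,y)\leq\max\{d(x,z),d(z,y)\}$ for all $x,y,z\in X$. *)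

theory Defs
  imports "HOL-Analysis.Analysis"
begin

datatype 'a graph = Graph (verts: "'a set") (edges: "'a set set")

definition simple_graph :: "'a graph \<Rightarrow> bool" where
  "simple_graph G \<longleftrightarrow>
     verts G \<noteq> {} \<and> edges G \<subseteq> {{u, v} | u v. u \<in> verts G \<and> v \<in> verts G \<and> u \<noteq> v}"

definition empty_graph :: "'a graph \<Rightarrow> bool" where
  "empty_graph G \<longleftrightarrow> edges G = {}"

(* A subgraph is itself a graph: its vertex set is nonempty and contains the ends of its edges. *)
definition subgraph :: "'a graph \<Rightarrow> 'a graph \<Rightarrow> bool" where
  "subgraph H G \<longleftrightarrow> simple_graph H \<and> verts H \<subseteq> verts G \<and> edges H \<subseteq> edges G"

definition graph_path :: "'a graph \<Rightarrow> 'a list \<Rightarrow> bool" where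
  "graph_path G p \<longleftrightarrow>
     p \<noteq> [] \<and> distinct p \<and> set p \<subseteq> verts G \<and> successively (\<lambda>u v. {u, v} \<in> edges G) p"

definition connected_graph :: "'a graph \<Rightarrow> bool" where
  "connected_graph G \<longleftrightarrow>
     (\<forall>u \<in> verts G. \<forall>v \<in> verts G. u \<noteq> v \<longrightarrow> (\<exists>p. graph_path G p \<and> hd p = u \<and> last p = v))"

definition graph_complement :: "'a graph \<Rightarrow> 'a graph" where
  "graph_complement G =
     Graph (verts G) {{x, y} | x y. x \<in> verts G \<and> y \<in> verts G \<and> x \<noteq> y \<and> {x, y} \<notin> edges G}"

(* The diameter may be infinite, hence a supremum of extended reals. It is used only for
   nonempty X; for empty X the supremum in ereal would be minus infinity. *)
definition metric_diam :: "'a set \<Rightarrow> ('a \<Rightarrow> 'a \<Rightarrow> real) \<Rightarrow> ereal" where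
  "metric_diam X d = (SUP (x, y) \<in> X \<times> X. ereal (d x y))"

definition diametrical_graph :: "'a set \<Rightarrow> ('a \<Rightarrow> 'a \<Rightarrow> real) \<Rightarrow> 'a graph" where
  "diametrical_graph X d =
     Graph X {{u, v} | u v. u \<in> X \<and> v \<in> X \<and> u \<noteq> v \<and> ereal (d u v) = metric_diam X d}"

(* Metric_space X d also asks for symmetry and nonnegativity of d off X. This is no restriction:
   a metric on X can be extended by 0, and everything here depends only on d on X. *)
definition ultrametric_space :: "'a set \<Rightarrow> ('a \<Rightarrow> 'a \<Rightarrow> real) \<Rightarrow> bool" where
  "ultrametric_space X d \<longleftrightarrow>
     Metric_space X d \<and> (\<forall>x \<in> X. \<forall>y \<in> X. \<forall>z \<in> X. d x y \<le> max (d x z) (d z y))"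

end

theory Submission imports Defs begin

text \<open>
  Both conditions say that the complement of \<open>\<Gamma>\<close> contains no path with three vertices.
  If the diameter is attained, a triangle violating the ultrametric inequality has two sides
  below the diameter, and these form such a path. Conversely, given such a path with middle
  vertex \<open>z\<close>, assign the distance 2 to the edges of \<open>\<Gamma>\<close>, the distance 1 to the other pairs
  containing \<open>z\<close>, and 3/2 to all remaining pairs. As all distances lie in \<open>[1, 2]\<close>, this is
  a metric; its diametrical graph is \<open>\<Gamma>\<close>, and the path violates the ultrametric inequality.
\<close>

lemma edge_graph_complement_iff:
  "{x, y} \<in> edges (graph_complement G) \<longleftrightarrow>
     x \<in> verts G \<and> y \<in> verts G \<and> x \<noteq> y \<and> {x, y} \<notin> edges G"
  by (auto simp: graph_complement_def doubleton_eq_iff insert_commute)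

lemma verts_graph_complement [simp]: "verts (graph_complement G) = verts G"
  by (simp add: graph_complement_def)

text \<open>The edge \<open>{x, y}\<close> does not remember the order of its ends; symmetry of
  \<open>d\<close>, taken from \<open>Metric_space\<close>, lets the condition be stated for the
  given order.\<close>

lemma edge_diametrical_graph_iff:
  assumes "Metric_space X d"
  shows "{x, y} \<in> edges (diametrical_graph X d) \<longleftrightarrow>
     x \<in> X \<and> y \<in> X \<and> x \<noteq> y \<and> ereal (d x y) = metric_diam X d"
  using Metric_space.commute[OF assms]
  by (auto simp: diametrical_graph_def doubleton_eq_iff)

lemma dist_le_metric_diam:
  assumes "x \<in> X" "y \<in> X"
  shows "ereal (d x y) \<le> metric_diam X d"
  unfolding metric_diam_def by (rule SUP_upper2[of "(x, y)"]) (use assms in auto)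

lemma metric_diam_eqI:
  assumes "x \<in> X" "y \<in> X" "d x y = D"
    and "\<And>u v. u \<in> X \<Longrightarrow> v \<in> X \<Longrightarrow> d u v \<le> D"
  shows "metric_diam X d = ereal D"
proof (rule antisym)
  show "metric_diam X d \<le> ereal D"
    unfolding metric_diam_def by (rule SUP_least) (use assms in auto)
  show "ereal D \<le> metric_diam X d"
    using dist_le_metric_diam[of x X y d] assms by simp
qed

lemma simple_graph_edgeE:
  assumes "simple_graph G" "e \<in> edges G"
  obtains u v where "e = {u, v}" "u \<in> verts G" "v \<in> verts G" "u \<noteq> v"
  using assms unfolding simple_graph_def by blast

lemma graph_path_rev:
  assumes "graph_path G p"
  shows "graph_path G (rev p)"
  using assms by (auto simp: graph_path_def insert_commute successively_rev)

text \<open>A path on three vertices is itself a connected subgraph that is too large. Without such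
  paths, any path joining two vertices is a single edge, so a connected subgraph with three vertices
  would have them pairwise adjacent in \<open>G\<close>, which gives a three-vertex path again. The
  conjunct \<open>finite\<close> guards against \<open>card\<close> being 0 on infinite sets. As
  \<open>G\<close> is arbitrary here, \<open>x \<noteq> z\<close> and \<open>z \<noteq> y\<close>
  exclude one-element edges.\<close>

lemma connected_subgraphs_small_iff:
  fixes G :: "'a graph"
  shows "(\<forall>H. subgraph H G \<and> connected_graph H \<longrightarrow> finite (verts H) \<and> card (verts H) \<le> 2) \<longleftrightarrow>
     (\<forall>x\<in>verts G. \<forall>y\<in>verts G. \<forall>z\<in>verts G.
        {x, z} \<in> edges G \<and> {z, y} \<in> edges G \<and> x \<noteq> z \<and> z \<noteq> y \<longrightarrow> x = y)"
    (is "?small \<longleftrightarrow> ?nopath")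
proof
  assume small: ?small
  show ?nopath
  proof (intro ballI impI)
    fix x y z
    assume V: "x \<in> verts G" "y \<in> verts G" "z \<in> verts G"
      and E: "{x, z} \<in> edges G \<and> {z, y} \<in> edges G \<and> x \<noteq> z \<and> z \<noteq> y"
    show "x = y"
    proof (rule ccontr)
      assume "x \<noteq> y"
      define H where "H = Graph {x, y, z} {{x, z}, {z, y}}"
      have "{{x, z}, {z, y}} \<subseteq> {{u, v} | u v. u \<in> {x, y, z} \<and> v \<in> {x, y, z} \<and> u \<noteq> v}"
        using E by blast
      hence "subgraph H G"
        using V E by (simp add: subgraph_def simple_graph_def H_def)
      moreover have "connected_graph H"
      proof -
        \<comment> \<open>Reversing a path swaps its ends, so three paths settle all six ordered
          pairs of distinct vertices.\<close>
        define joined where "joined u v \<longleftrightarrow> (\<exists>p. graph_path H p \<and> hd p = u \<and> last p = v)" for u v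
        have "joined (hd p) (last p)" "joined (last p) (hd p)" if "graph_path H p" for p
          using that graph_path_rev[OF that] unfolding joined_def
          by (blast, metis graph_path_def hd_rev last_rev)
        moreover have "graph_path H [x, z]" "graph_path H [z, y]" "graph_path H [x, z, y]"
          using E \<open>x \<noteq> y\<close> by (auto simp: graph_path_def H_def)
        ultimately have "joined x z" "joined z x" "joined z y" "joined y z" "joined x y" "joined y x"
          by fastforce+
        hence "\<forall>u\<in>{x, y, z}. \<forall>v\<in>{x, y, z}. u \<noteq> v \<longrightarrow> joined u v"
          by blast
        thus ?thesis by (simp add: connected_graph_def joined_def H_def)
      qed
      ultimately have "card (verts H) \<le> 2"
        using small by blast
      thus False
        using E \<open>x \<noteq> y\<close> by (auto simp: H_def)
    qed
  qed
next
  assume nopath: ?nopath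
  show ?small
  proof (intro allI impI, elim conjE)
    fix H assume sub: "subgraph H G" and conn: "connected_graph H"
    have adj: "{u, v} \<in> edges G" if uv: "u \<in> verts H" "v \<in> verts H" "u \<noteq> v" for u v
    proof -
      obtain p where p: "graph_path H p" "hd p = u" "last p = v"
        using conn uv unfolding connected_graph_def by blast
      then obtain w q where "p = u # w # q"
        using \<open>u \<noteq> v\<close> by (cases p; cases "tl p") (auto simp: graph_path_def)
      \<comment> \<open>A third vertex \<open>t\<close> on the path would make \<open>u\<close>,
        \<open>w\<close>, \<open>t\<close> a forbidden path in \<open>G\<close>; the three differ
        because \<open>graph_path\<close> repeats no vertex.\<close>
      moreover have "q = []"
      proof (cases q)
        case (Cons t r)
        hence "{u, w} \<in> edges G" "{w, t} \<in> edges G" "u \<noteq> w" "w \<noteq> t" "u \<noteq> t"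
          "u \<in> verts G" "w \<in> verts G" "t \<in> verts G"
          using p \<open>p = u # w # q\<close> sub by (auto simp: graph_path_def subgraph_def)
        thus ?thesis using nopath by blast
      qed
      ultimately show ?thesis
        using p sub by (auto simp: graph_path_def subgraph_def)
    qed
    show "finite (verts H) \<and> card (verts H) \<le> 2"
    proof (rule ccontr)
      assume "\<not> (finite (verts H) \<and> card (verts H) \<le> 2)"
      \<comment> \<open>An infinite vertex set and a finite one with more than two elements both
        contain a three-element subset.\<close>
      then obtain T where T: "T \<subseteq> verts H" "card T = 3"
        by (metis infinite_arbitrarily_large obtain_subset_with_card_n not_less_eq_eq
            numeral_2_eq_2 numeral_3_eq_3)
      then obtain a b c where "T = {a, b, c}" "a \<noteq> b" "a \<noteq> c" "b \<noteq> c"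
        unfolding card_3_iff by blast
      hence abc: "a \<in> verts H" "b \<in> verts H" "c \<in> verts H" using T by auto
      hence "{a, b} \<in> edges G" "{b, c} \<in> edges G" "a \<in> verts G" "b \<in> verts G" "c \<in> verts G"
        using adj \<open>a \<noteq> b\<close> \<open>b \<noteq> c\<close> sub by (auto simp: subgraph_def)
      thus False
        using nopath \<open>a \<noteq> b\<close> \<open>b \<noteq> c\<close> \<open>a \<noteq> c\<close> by blast
    qed
  qed
qed

lemma ultrametric_space_if_attained_diameter:
  assumes M: "Metric_space X d" and ne: "edges (diametrical_graph X d) \<noteq> {}"
    and nopath: "\<And>x y z. \<lbrakk>x \<in> X; y \<in> X; z \<in> X; x \<noteq> z; z \<noteq> y;
        {x, z} \<notin> edges (diametrical_graph X d); {z, y} \<notin> edges (diametrical_graph X d)\<rbrakk> \<Longrightarrow> x = y"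
  shows "ultrametric_space X d"
proof -
  interpret Metric_space X d by (rule M)
  \<comment> \<open>An edge has a real length equal to the diameter, so the supremum in
    \<open>ereal\<close> is finite.\<close>
  obtain D where D: "metric_diam X d = ereal D"
    using ne by (auto simp: diametrical_graph_def dest: sym)
  have le: "d u v \<le> D" if "u \<in> X" "v \<in> X" for u v
    using dist_le_metric_diam[OF that, of d] D by simp
  have edge: "{u, v} \<in> edges (diametrical_graph X d) \<longleftrightarrow> u \<in> X \<and> v \<in> X \<and> u \<noteq> v \<and> d u v = D" for u v
    by (simp add: edge_diametrical_graph_iff[OF M] D)
  have "d x y \<le> max (d x z) (d z y)" if xyz: "x \<in> X" "y \<in> X" "z \<in> X" for x y z
  proof (rule ccontr)
    assume "\<not> ?thesis"
    hence lt: "d x z < d x y" "d z y < d x y" by auto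
    have "x \<noteq> z" "z \<noteq> y" using lt by auto
    \<comment> \<open>\<open>d x y\<close> is positive, since it exceeds the nonnegative
      \<open>d x z\<close>. As \<open>d x y \<le> D\<close>, both shorter sides are below
      \<open>D\<close> and hence are not edges, so \<open>nopath\<close> would force
      \<open>x = y\<close>.\<close>
    moreover have "x \<noteq> y" using lt nonneg[of x z] zero[of x y] xyz by (metis leD)
    ultimately show False
      using nopath[of x y z] lt le[of x y] xyz by (auto simp: edge)
  qed
  thus ?thesis using M by (simp add: ultrametric_space_def)
qed

text \<open>Membership in \<open>E\<close> is tested before \<open>z\<close>, so edges at
  \<open>z\<close> also get length 2. The value 3/2 only has to lie strictly between 1 and 2: below
  2 to stay off the diameter, above 1 to break the ultrametric inequality at
  \<open>z\<close>.\<close>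

definition star_metric :: "'a set set \<Rightarrow> 'a \<Rightarrow> 'a \<Rightarrow> 'a \<Rightarrow> real" where
  "star_metric E z u v =
     (if u = v then 0 else if {u, v} \<in> E then 2 else if z \<in> {u, v} then 1 else 3/2)"

lemma star_metric_le_2: "star_metric E z u v \<le> 2"
  by (simp add: star_metric_def)

lemma star_metric_eq_2_iff: "star_metric E z u v = 2 \<longleftrightarrow> u \<noteq> v \<and> {u, v} \<in> E"
  by (simp add: star_metric_def)

lemma Metric_space_star_metric: "Metric_space X (star_metric E z)"
proof
  show "star_metric E z u w \<le> star_metric E z u v + star_metric E z v w" for u v w
  \<comment> \<open>If two consecutive points coincide, one summand is 0 and the other equals the
    left side; otherwise the bound is 2 = 1 + 1.\<close>
  proof (cases "u = v \<or> v = w")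
    case False
    hence "1 \<le> star_metric E z u v" "1 \<le> star_metric E z v w"
      by (auto simp: star_metric_def)
    thus ?thesis using star_metric_le_2[of E z u w] by linarith
  qed (auto simp: star_metric_def)
  show "star_metric E z u v = star_metric E z v u" for u v
    by (simp add: star_metric_def doubleton_eq_iff insert_commute eq_commute)
qed (auto simp: star_metric_def)

text \<open>An edge of the nonempty graph attains the upper bound 2, which is therefore the
  diameter, and length 2 occurs exactly on the edges, whatever the centre \<open>z\<close>.\<close>

lemma diametrical_graph_star_metric:
  assumes "simple_graph G" "\<not> empty_graph G"
  shows "diametrical_graph (verts G) (star_metric (edges G) z) = G"
proof -
  let ?d = "star_metric (edges G) z"
  obtain a b where "{a, b} \<in> edges G" "a \<in> verts G" "b \<in> verts G" "a \<noteq> b"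
    using assms simple_graph_edgeE unfolding empty_graph_def by (metis ex_in_conv)
  hence "metric_diam (verts G) ?d = ereal 2"
    by (intro metric_diam_eqI[of a _ b]) (auto simp: star_metric_eq_2_iff star_metric_le_2)
  hence "edges (diametrical_graph (verts G) ?d) =
      {{u, v} | u v. u \<in> verts G \<and> v \<in> verts G \<and> u \<noteq> v \<and> {u, v} \<in> edges G}"
    by (simp add: diametrical_graph_def star_metric_eq_2_iff cong: conj_cong)
  also have "\<dots> = edges G"
    using assms(1) unfolding simple_graph_def by blast
  finally have "edges (diametrical_graph (verts G) ?d) = edges G" .
  thus ?thesis by (simp add: graph.expand diametrical_graph_def)
qed

theorem theorem3p3:
  fixes \<Gamma> :: "'a graph" and X :: "'a set"
  assumes "simple_graph \<Gamma>" and "\<not> empty_graph \<Gamma>" and "X = verts \<Gamma>"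
  shows "(\<forall>H. subgraph H (graph_complement \<Gamma>) \<and> connected_graph H
              \<longrightarrow> finite (verts H) \<and> card (verts H) \<le> 2)
     \<longleftrightarrow> (\<forall>d. Metric_space X d \<longrightarrow> diametrical_graph X d = \<Gamma> \<longrightarrow> ultrametric_space X d)"
  unfolding connected_subgraphs_small_iff
proof (intro iffI allI impI ballI)
  fix d
  assume nopath: "\<forall>x\<in>verts (graph_complement \<Gamma>). \<forall>y\<in>verts (graph_complement \<Gamma>).
      \<forall>z\<in>verts (graph_complement \<Gamma>). {x, z} \<in> edges (graph_complement \<Gamma>) \<and>
        {z, y} \<in> edges (graph_complement \<Gamma>) \<and> x \<noteq> z \<and> z \<noteq> y \<longrightarrow> x = y"
    and M: "Metric_space X d" and diam: "diametrical_graph X d = \<Gamma>"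
  show "ultrametric_space X d"
  proof (rule ultrametric_space_if_attained_diameter[OF M], unfold diam)
    show "edges \<Gamma> \<noteq> {}" using assms(2) by (simp add: empty_graph_def)
    fix x y z
    assume "x \<in> X" "y \<in> X" "z \<in> X" "x \<noteq> z" "z \<noteq> y" "{x, z} \<notin> edges \<Gamma>" "{z, y} \<notin> edges \<Gamma>"
    thus "x = y"
      using nopath unfolding assms(3) verts_graph_complement edge_graph_complement_iff by blast
  qed
next
  fix x y z
  assume ultra: "\<forall>d. Metric_space X d \<longrightarrow> diametrical_graph X d = \<Gamma> \<longrightarrow> ultrametric_space X d"
    and V: "x \<in> verts (graph_complement \<Gamma>)" "y \<in> verts (graph_complement \<Gamma>)"
      "z \<in> verts (graph_complement \<Gamma>)"
    and E: "{x, z} \<in> edges (graph_complement \<Gamma>) \<and> {z, y} \<in> edges (graph_complement \<Gamma>) \<and>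
      x \<noteq> z \<and> z \<noteq> y"
  let ?d = "star_metric (edges \<Gamma>) z"
  have "ultrametric_space X ?d"
    using ultra[rule_format, OF Metric_space_star_metric]
      diametrical_graph_star_metric[OF assms(1,2)] assms(3) by simp
  hence "?d x y \<le> max (?d x z) (?d z y)"
    using V assms(3) by (simp add: ultrametric_space_def)
  \<comment> \<open>Both pairs at \<open>z\<close> are non-edges of \<open>\<Gamma>\<close>, so the
    right side is 1. If \<open>x \<noteq> y\<close>, the pair \<open>{x, y}\<close> avoids
    \<open>z\<close> and has length 3/2 or 2.\<close>
  thus "x = y"
    using E by (auto simp: edge_graph_complement_iff star_metric_def split: if_splits)
qed

end
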